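(* $F_e(K_3,J_4;5)\le 27$; that is, there exists a $K_5$-free graph $G$ on 27 vertices such that every red-blue coloring of $E(G)$ contains a red $K_3$ or a blue $J_4$.
   Context: All graphs are finite and simple. $J_4$ denotes $K_4$ with one edge removed. $G\rightarrow(H_1,H_2)^e$ means: for every coloring of $E(G)$ with colors 1, 2 there is $i$ such that the subgraph formed by the edges of color $i$ contains a (not necessarily induced) copy of $H_i$. The edge Folkman number $F_e(H_1,H_2;k)$ is the minimum number of vertices of a $K_k$-free graph $G$ with $G\rightarrow(H_1,H_2)^e$. *)

theory Defs
  imports Main
begin

definition simple_graph :: "'a set \<Rightarrow> 'a set set \<Rightarrow> bool" where
  "simple_graph V E \<longleftrightarrow> finite V \<and>
     (\<forall>e\<in>E. \<exists>u v. u \<in> V \<and> v \<in> V \<and> u \<noteq> v \<and> e = {u, v})"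

definition has_copy :: "'b set \<Rightarrow> 'b set set \<Rightarrow> 'a set set \<Rightarrow> bool" where
  "has_copy HV HE F \<longleftrightarrow> (\<exists>f. inj_on f HV \<and> (\<forall>e\<in>HE. f ` e \<in> F))"

definition complete_edges :: "nat \<Rightarrow> nat set set" where
  "complete_edges k = {{i, j} | i j. i < k \<and> j < k \<and> i \<noteq> j}"

definition J4_edges :: "nat set set" where
  "J4_edges = complete_edges 4 - {{2, 3}}"

definition edge_arrows ::
  "'a set set \<Rightarrow> 'b set \<Rightarrow> 'b set set \<Rightarrow> 'c set \<Rightarrow> 'c set set \<Rightarrow> bool" where
  "edge_arrows E H1V H1E H2V H2E \<longleftrightarrow>
     (\<forall>R. R \<subseteq> E \<longrightarrow> has_copy H1V H1E R \<or> has_copy H2V H2E (E - R))"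

end

theory Submission
  imports Defs
begin

text \<open>
  Let \<open>H\<close> have vertices \<open>0, \<dots>, 24\<close>, two of them adjacent when their difference is a quadratic
  nonresidue modulo 17. So \<open>H\<close> is the Paley graph on 17 vertices (up to multiplication by a nonresidue)
  with eight of its vertices doubled. The Paley graph has no \<open>K\<^sub>4\<close>, hence joining two nonadjacent apex
  vertices 25 and 26 to all of \<open>H\<close> creates no \<open>K\<^sub>5\<close>. A coloring of the edges without a red triangle
  and without a blue \<open>J\<^sub>4\<close> is a model of a set of 5852 clauses, one for each triangle and each
  \<open>J\<^sub>4\<close> of the graph; the method \<open>argo\<close> refutes them.
\<close>

section \<open>The graph\<close>

text \<open>Modulo 17, the term \<open>u + 16 * v\<close> is \<open>u - v\<close>; the list consists of the nonresidues.\<close>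

definition adj :: "nat \<Rightarrow> nat \<Rightarrow> bool" where
  "adj u v \<longleftrightarrow> u < 27 \<and> v < 27 \<and>
     (if u < 25 \<and> v < 25 then (u + 16 * v) mod 17 \<in> {3, 5, 6, 7, 10, 11, 12, 14}
      else u < 25 \<or> v < 25)"

text \<open>-1 = 4^2 is a square modulo 17, so negation maps nonresidues to nonresidues; the factor
  16 stands for -1.\<close>

lemma nonresidue_minus: "(u + 16 * v) mod 17 \<in> {3, 5, 6, 7, 10, 11, 12, 14} \<Longrightarrow>
    (v + 16 * u) mod 17 \<in> {3, 5, 6, 7, 10, 11, 12, 14::nat}"
proof -
  assume "(u + 16 * v) mod 17 \<in> {3, 5, 6, 7, 10, 11, 12, 14}"
  then have "16 * ((u + 16 * v) mod 17) mod 17 \<in> {3, 5, 6, 7, 10, 11, 12, 14}"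
    by auto
  also have "16 * ((u + 16 * v) mod 17) mod 17 = (v + 16 * u + 17 * (15 * v)) mod 17"
    by (simp add: mod_mult_right_eq algebra_simps)
  also have "\<dots> = (v + 16 * u) mod 17"
    by (rule mod_mult_self2)
  finally show ?thesis .
qed

lemma adj_sym: "adj u v \<Longrightarrow> adj v u"
  using nonresidue_minus[of u v] by (auto simp: adj_def split: if_splits)

lemma adj_irrefl: "\<not> adj u u"
  by (auto simp: adj_def)

lemma adj_neq: "adj u v \<Longrightarrow> u \<noteq> v"
  using adj_irrefl by blast

lemma adj_less: "adj u v \<Longrightarrow> u < 27" "adj u v \<Longrightarrow> v < 27"
  by (simp_all add: adj_def)

text \<open>
  As congruence rules, these keep the simplifier from rewriting the predicates before they are
  applied to numerals.
\<close>

lemma ball_arg_cong: "A = B \<Longrightarrow> Ball A P = Ball B P"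
  and list_all_arg_cong: "xs = ys \<Longrightarrow> list_all P xs = list_all P ys"
  and filter_arg_cong: "xs = ys \<Longrightarrow> filter P xs = filter P ys"
  and sorted_wrt_arg_cong: "xs = ys \<Longrightarrow> sorted_wrt R xs = sorted_wrt R ys"
  by simp_all

text \<open>Translating \<open>a\<close> to 0 leaves the differences of \<open>a\<close> from
  \<open>b\<close>, \<open>c\<close>, \<open>d\<close>, so a finite check over triples in
  \<open>D\<close> suffices. As 0 is not in \<open>D\<close>, two copies of one residue are never
  joined, which covers the doubled vertices.\<close>

lemma no_K4_nonresidues:
  fixes a b c d :: nat
  defines "D \<equiv> {3, 5, 6, 7, 10, 11, 12, 14 :: nat}"
  shows "\<not> ((a + 16 * b) mod 17 \<in> D \<and> (a + 16 * c) mod 17 \<in> D \<and> (a + 16 * d) mod 17 \<in> D \<and>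
           (b + 16 * c) mod 17 \<in> D \<and> (b + 16 * d) mod 17 \<in> D \<and> (c + 16 * d) mod 17 \<in> D)"
proof -
  \<comment> \<open>Modulo 17 this reads (a - q) - (a - p) = p - q.\<close>
  have diff: "((a + 16 * q) mod 17 + 16 * ((a + 16 * p) mod 17)) mod 17 = (p + 16 * q) mod 17" for p q
  proof -
    have "((a + 16 * q) mod 17 + 16 * ((a + 16 * p) mod 17)) mod 17
        = (a + 16 * q + 16 * (a + 16 * p)) mod 17"
      by (intro mod_add_cong) (simp_all only: mod_mod_trivial mod_mult_right_eq)
    also have "a + 16 * q + 16 * (a + 16 * p) = p + 16 * q + 17 * (a + 15 * p)"
      by simp
    also have "\<dots> mod 17 = (p + 16 * q) mod 17"
      by (rule mod_mult_self2)
    finally show ?thesis .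
  qed
  have "\<forall>x\<in>D. \<forall>y\<in>D. (y + 16 * x) mod 17 \<in> D \<longrightarrow>
      (\<forall>z\<in>D. (z + 16 * x) mod 17 \<in> D \<longrightarrow> (z + 16 * y) mod 17 \<notin> D)"
    by (simp add: D_def cong: ball_arg_cong)
  then have "(y + 16 * x) mod 17 \<in> D \<longrightarrow> (z + 16 * x) mod 17 \<in> D \<longrightarrow> (z + 16 * y) mod 17 \<notin> D"
    if "x \<in> D" "y \<in> D" "z \<in> D" for x y z
    using that by blast
  from this[of "(a + 16 * b) mod 17" "(a + 16 * c) mod 17" "(a + 16 * d) mod 17"]
  show ?thesis
    unfolding diff by blast
qed

definition edges :: "nat set set" where
  "edges = {{u, v} | u v. adj u v}"

lemma edges_iff: "{u, v} \<in> edges \<longleftrightarrow> adj u v"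
  by (auto simp: edges_def doubleton_eq_iff dest: adj_sym)

lemma no_K4_below_25:
  assumes "a < 25" "b < 25" "c < 25" "d < 25"
    and "adj a b" "adj a c" "adj a d" "adj b c" "adj b d" "adj c d"
  shows False
  using assms no_K4_nonresidues[of a b c d] by (auto simp: adj_def)

section \<open>Copies of complete graphs and of J4\<close>

lemma has_copy_complete_iff:
  "has_copy {..<k} (complete_edges k) F \<longleftrightarrow>
     (\<exists>f. inj_on f {..<k} \<and> (\<forall>i<k. \<forall>j<k. i \<noteq> j \<longrightarrow> {f i, f j} \<in> F))"
proof -
  have "(\<forall>e\<in>complete_edges k. f ` e \<in> F) \<longleftrightarrow> (\<forall>i<k. \<forall>j<k. i \<noteq> j \<longrightarrow> {f i, f j} \<in> F)" for f :: "nat \<Rightarrow> 'a"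
    by (auto simp: complete_edges_def) (metis image_empty image_insert)
  then show ?thesis
    by (simp add: has_copy_def)
qed

lemma has_copy_K3:
  assumes "{u, v} \<in> F" "{u, w} \<in> F" "{v, w} \<in> F" "distinct [u, v, w]"
  shows "has_copy {..<3} (complete_edges 3) F"
  unfolding has_copy_complete_iff
  using assms by (intro exI[of _ "(!) [u, v, w]"])
    (auto simp: inj_on_def insert_commute less_Suc_eq numeral_3_eq_3)

text \<open>\<open>u\<close> and \<open>v\<close> play the vertices of degree 3; \<open>x\<close>
  and \<open>y\<close> take positions 2 and 3, the ends of the removed edge.\<close>

lemma has_copy_J4:
  assumes "{u, v} \<in> F" "{u, x} \<in> F" "{v, x} \<in> F" "{u, y} \<in> F" "{v, y} \<in> F" "distinct [u, v, x, y]"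
  shows "has_copy {..<4::nat} J4_edges F"
  unfolding has_copy_def J4_edges_def complete_edges_def
  using assms by (intro exI[of _ "(!) [u, v, x, y]"])
    (auto simp: inj_on_def insert_commute less_Suc_eq eval_nat_numeral)

text \<open>The apexes are nonadjacent, so a K5 would use at most one of them and leave a K4 among
  the vertices below 25.\<close>

lemma no_K5: "\<not> has_copy {..<5} (complete_edges 5) edges"
proof
  assume "has_copy {..<5} (complete_edges 5) edges"
  then obtain f :: "nat \<Rightarrow> nat" where f: "\<And>i j. i < 5 \<Longrightarrow> j < 5 \<Longrightarrow> i \<noteq> j \<Longrightarrow> adj (f i) (f j)"
    by (auto simp: has_copy_complete_iff edges_iff)
  have apex: "f i < 25 \<or> f j < 25" if "i < 5" "j < 5" "i \<noteq> j" for i j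
    using f[OF that] by (auto simp: adj_def split: if_splits)
  obtain m where m: "\<forall>i<5. i \<noteq> m \<longrightarrow> f i < 25"
    using apex by blast
  have K4: False if "i < 5" "j < 5" "k < 5" "l < 5" "distinct [i, j, k, l]" "m \<notin> {i, j, k, l}" for i j k l
    using that m no_K4_below_25[of "f i" "f j" "f k" "f l"] by (auto simp: f)
  \<comment> \<open>The case \<open>m > 3\<close> joins \<open>m = 4\<close> with an
    \<open>m\<close> out of range; either way the indices 0 to 3 avoid \<open>m\<close>.\<close>
  consider "m = 0" | "m = 1" | "m = 2" | "m = 3" | "m > 3" by linarith
  then show False
    by cases (use K4[of 1 2 3 4] K4[of 0 2 3 4] K4[of 0 1 3 4] K4[of 0 1 2 4] K4[of 0 1 2 3] in auto)
qed

section \<open>Colorings\<close>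

definition nbrs :: "nat \<Rightarrow> nat list" where
  "nbrs u = filter (adj u) [0..<27]"

definition common_nbrs :: "nat \<Rightarrow> nat \<Rightarrow> nat list" where
  "common_nbrs u v = filter (\<lambda>x. x \<in> set (nbrs v)) (nbrs u)"

text \<open>
  Colorings are restricted to arguments in increasing order, so that each edge gives a single
  propositional atom.
\<close>

definition no_red_triangle :: "(nat \<Rightarrow> nat \<Rightarrow> bool) \<Rightarrow> bool" where
  "no_red_triangle r \<longleftrightarrow> list_all (\<lambda>u. list_all (\<lambda>v. list_all (\<lambda>w.
     \<not> r u v \<or> \<not> r u w \<or> \<not> r v w) (filter (\<lambda>w. v < w) (common_nbrs u v)))
     (filter (\<lambda>v. u < v) (nbrs u))) [0..<27]"

text \<open>\<open>sorted_wrt\<close> serves as a quantifier over pairs of positions in the list, so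
  each unordered pair \<open>x\<close>, \<open>y\<close> of common neighbors gives one
  clause.\<close>

definition no_blue_J4 :: "(nat \<Rightarrow> nat \<Rightarrow> bool) \<Rightarrow> bool" where
  "no_blue_J4 r \<longleftrightarrow> list_all (\<lambda>u. list_all (\<lambda>v. sorted_wrt (\<lambda>x y.
     r u v \<or> r (min u x) (max u x) \<or> r (min v x) (max v x) \<or>
     r (min u y) (max u y) \<or> r (min v y) (max v y)) (common_nbrs u v))
     (filter (\<lambda>v. u < v) (nbrs u))) [0..<27]"

lemma sorted_wrt_if_distinct:
  assumes "distinct xs" "\<And>x y. x \<in> set xs \<Longrightarrow> y \<in> set xs \<Longrightarrow> x \<noteq> y \<Longrightarrow> P x y"
  shows "sorted_wrt P xs"
  using assms by (induction xs) auto

lemma no_red_triangleI: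
  assumes "\<And>u v w. adj u v \<Longrightarrow> adj u w \<Longrightarrow> adj v w \<Longrightarrow> \<not> r u v \<or> \<not> r u w \<or> \<not> r v w"
  shows "no_red_triangle r"
  unfolding no_red_triangle_def list_all_iff
  by (intro ballI assms) (auto simp: common_nbrs_def nbrs_def)

lemma no_blue_J4I:
  assumes sym: "\<And>u v. r u v = r v u"
    and J4: "\<And>u v x y. adj u v \<Longrightarrow> adj u x \<Longrightarrow> adj v x \<Longrightarrow> adj u y \<Longrightarrow> adj v y \<Longrightarrow> x \<noteq> y \<Longrightarrow>
      r u v \<or> r u x \<or> r v x \<or> r u y \<or> r v y"
  shows "no_blue_J4 r"
proof -
  have minmax: "r (min u v) (max u v) = r u v" for u v
    using sym[of u v] by (simp add: min_def max_def)
  show ?thesis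
    unfolding no_blue_J4_def list_all_iff minmax
    by (intro ballI sorted_wrt_if_distinct J4) (auto simp: common_nbrs_def nbrs_def)
qed

lemma upt_27: "[0..<27] = [0, 1, 2, 3, 4, 5, 6, 7, 8, 9, 10, 11, 12, 13, 14, 15, 16, 17, 18,
    19, 20, 21, 22, 23, 24, 25, 26 :: nat]"
  by (simp add: upt_rec)

text \<open>The simplifier turns \<open>1\<close> into \<open>Suc 0\<close> before these equations apply.\<close>

lemma nbrs_table:
  "nbrs 0 = [3, 5, 6, 7, 10, 11, 12, 14, 20, 22, 23, 24, 25, 26]"
  "nbrs (Suc 0) = [4, 6, 7, 8, 11, 12, 13, 15, 21, 23, 24, 25, 26]"
  "nbrs 2 = [5, 7, 8, 9, 12, 13, 14, 16, 22, 24, 25, 26]"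
  "nbrs 3 = [0, 6, 8, 9, 10, 13, 14, 15, 17, 23, 25, 26]"
  "nbrs 4 = [1, 7, 9, 10, 11, 14, 15, 16, 18, 24, 25, 26]"
  "nbrs 5 = [0, 2, 8, 10, 11, 12, 15, 16, 17, 19, 25, 26]"
  "nbrs 6 = [0, 1, 3, 9, 11, 12, 13, 16, 17, 18, 20, 25, 26]"
  "nbrs 7 = [0, 1, 2, 4, 10, 12, 13, 14, 17, 18, 19, 21, 25, 26]"
  "nbrs 8 = [1, 2, 3, 5, 11, 13, 14, 15, 18, 19, 20, 22, 25, 26]"
  "nbrs 9 = [2, 3, 4, 6, 12, 14, 15, 16, 19, 20, 21, 23, 25, 26]"
  "nbrs 10 = [0, 3, 4, 5, 7, 13, 15, 16, 17, 20, 21, 22, 24, 25, 26]"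
  "nbrs 11 = [0, 1, 4, 5, 6, 8, 14, 16, 17, 18, 21, 22, 23, 25, 26]"
  "nbrs 12 = [0, 1, 2, 5, 6, 7, 9, 15, 17, 18, 19, 22, 23, 24, 25, 26]"
  "nbrs 13 = [1, 2, 3, 6, 7, 8, 10, 16, 18, 19, 20, 23, 24, 25, 26]"
  "nbrs 14 = [0, 2, 3, 4, 7, 8, 9, 11, 17, 19, 20, 21, 24, 25, 26]"
  "nbrs 15 = [1, 3, 4, 5, 8, 9, 10, 12, 18, 20, 21, 22, 25, 26]"
  "nbrs 16 = [2, 4, 5, 6, 9, 10, 11, 13, 19, 21, 22, 23, 25, 26]"
  "nbrs 17 = [3, 5, 6, 7, 10, 11, 12, 14, 20, 22, 23, 24, 25, 26]"
  "nbrs 18 = [4, 6, 7, 8, 11, 12, 13, 15, 21, 23, 24, 25, 26]"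
  "nbrs 19 = [5, 7, 8, 9, 12, 13, 14, 16, 22, 24, 25, 26]"
  "nbrs 20 = [0, 6, 8, 9, 10, 13, 14, 15, 17, 23, 25, 26]"
  "nbrs 21 = [1, 7, 9, 10, 11, 14, 15, 16, 18, 24, 25, 26]"
  "nbrs 22 = [0, 2, 8, 10, 11, 12, 15, 16, 17, 19, 25, 26]"
  "nbrs 23 = [0, 1, 3, 9, 11, 12, 13, 16, 17, 18, 20, 25, 26]"
  "nbrs 24 = [0, 1, 2, 4, 10, 12, 13, 14, 17, 18, 19, 21, 25, 26]"
  "nbrs 25 = [0, 1, 2, 3, 4, 5, 6, 7, 8, 9, 10, 11, 12, 13, 14, 15, 16, 17, 18, 19, 20, 21, 22, 23, 24]"
  "nbrs 26 = [0, 1, 2, 3, 4, 5, 6, 7, 8, 9, 10, 11, 12, 13, 14, 15, 16, 17, 18, 19, 20, 21, 22, 23, 24]"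
  by (simp_all add: nbrs_def upt_27 adj_def)

text \<open>Stands in for \<open>sorted_wrt.simps(2)\<close>, whose bounded quantifier is not
  governed by \<open>list_all_arg_cong\<close>.\<close>

lemma sorted_wrt_Cons_list_all:
  "sorted_wrt P (x # xs) \<longleftrightarrow> list_all (P x) xs \<and> sorted_wrt P xs"
  by (simp add: list_all_iff)

text \<open>
  The method \<open>argo\<close> copes with thousands of clauses only as separate premises, and splitting them off
  one at a time takes quadratic time.
\<close>

lemma conj16E:
  "A1 \<and> A2 \<and> A3 \<and> A4 \<and> A5 \<and> A6 \<and> A7 \<and> A8 \<and>
   A9 \<and> A10 \<and> A11 \<and> A12 \<and> A13 \<and> A14 \<and> A15 \<and> A16 \<and> R \<Longrightarrow>
   (A1 \<Longrightarrow> A2 \<Longrightarrow> A3 \<Longrightarrow> A4 \<Longrightarrow> A5 \<Longrightarrow> A6 \<Longrightarrow> A7 \<Longrightarrow> A8 \<Longrightarrow>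
   A9 \<Longrightarrow> A10 \<Longrightarrow> A11 \<Longrightarrow> A12 \<Longrightarrow> A13 \<Longrightarrow> A14 \<Longrightarrow> A15 \<Longrightarrow> A16 \<Longrightarrow> R \<Longrightarrow> Q) \<Longrightarrow> Q"
  by blast

lemma no_good_coloring:
  assumes "no_red_triangle r" "no_blue_J4 r"
  shows False
  using assms [[argo_timeout = 3000]]
  \<comment> \<open>Without \<open>disj_not1\<close> the clauses stay disjunctions instead of
    becoming implications.\<close>
  apply (simp (no_asm_use) add: no_red_triangle_def no_blue_J4_def common_nbrs_def nbrs_table upt_27
      sorted_wrt_Cons_list_all del: sorted_wrt.simps(2) disj_not1
      cong: list_all_arg_cong filter_arg_cong sorted_wrt_arg_cong)
  apply (elim conj16E)
  apply (elim conjE)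
  apply argo
  done

theorem theorem11:
  shows "\<exists>(V :: nat set) (E :: nat set set).
           simple_graph V E \<and> card V = 27 \<and>
           \<not> has_copy {..<5} (complete_edges 5) E \<and>
           edge_arrows E {..<3::nat} (complete_edges 3) {..<4::nat} J4_edges"
proof (intro exI conjI)
  show "simple_graph {..<27} edges"
    unfolding simple_graph_def edges_def using adj_neq adj_less by fastforce
  show "card {..<27::nat} = 27"
    by simp
  show "\<not> has_copy {..<5} (complete_edges 5) edges"
    by (fact no_K5)
  show "edge_arrows edges {..<3::nat} (complete_edges 3) {..<4::nat} J4_edges"
    unfolding edge_arrows_def
  proof (intro allI impI, rule ccontr)
    fix R
    assume "\<not> (has_copy {..<3::nat} (complete_edges 3) R \<or> has_copy {..<4::nat} J4_edges (edges - R))"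
    then have no_red: "\<not> has_copy {..<3::nat} (complete_edges 3) R"
      and no_blue: "\<not> has_copy {..<4::nat} J4_edges (edges - R)"
      by auto
    let ?r = "\<lambda>u v. {u, v} \<in> R"
    have "no_red_triangle ?r"
    proof (rule no_red_triangleI)
      show "{u, v} \<notin> R \<or> {u, w} \<notin> R \<or> {v, w} \<notin> R" if "adj u v" "adj u w" "adj v w" for u v w
        using has_copy_K3[of u v R w] no_red that adj_neq by auto
    qed
    moreover have "no_blue_J4 ?r"
    proof (rule no_blue_J4I)
      show "({u, v} \<in> R) = ({v, u} \<in> R)" for u v
        by (simp add: insert_commute)
      show "{u, v} \<in> R \<or> {u, x} \<in> R \<or> {v, x} \<in> R \<or> {u, y} \<in> R \<or> {v, y} \<in> R"
        if "adj u v" "adj u x" "adj v x" "adj u y" "adj v y" "x \<noteq> y" for u v x y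
        \<comment> \<open>If all five edges avoid \<open>R\<close>, they form a blue J4; its
          vertices are distinct by \<open>adj_neq\<close> and \<open>x \<noteq> y\<close>.\<close>
        using has_copy_J4[of u v "edges - R" x y] no_blue that adj_neq by (auto simp: edges_iff)
    qed
    ultimately show False
      by (rule no_good_coloring)
  qed
qed

end
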